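(* Let $\mathbb{M}$ be a complete MV-chain, $Y$ a finite set and $f:\mathbb{M}^Y\to\mathbb{M}^Y$ a non-expansive function. Given a pre-fixpoint $a\in\mathbb{M}^Y$ of $f$ (i.e. $f(a)\sqsubseteq a$), let $[Y]_{a=f(a)}=\{y\in[Y]_a\mid a(y)=f(a)(y)\}$ and define $f_a^{*}:\mathbf{2}^{[Y]_{a=f(a)}}\to\mathbf{2}^{[Y]_{a=f(a)}}$ by $f_a^{*}(Y')=f_a^{\#}(Y')\cap[Y]_{a=f(a)}$, where $f_a^{\#}:\mathbf{2}^{[Y]_a}\to\mathbf{2}^{[Y]_{f(a)}}$ is the $a$-approximation of $f$. If $\nu f_a^{*}=\emptyset$ then $\nu f\sqsubseteq a$.
   Context: MV-algebras: an MV-algebra is a tuple $\mathbb{M}=(M,\oplus,0,\overline{(\cdot)})$ where $(M,\oplus,0)$ is a commutative monoid and $\overline{(\cdot)}:M\to M$ satisfies $\overline{\overline{x}}=x$, $x\oplus\overline{0}=\overline{0}$ and $\overline{(\overline{x}\oplus y)}\oplus y=\overline{(\overline{y}\oplus x)}\oplus x$ for all $x,y$. Put $1=\overline{0}$, $x\otimes y=\overline{\overline{x}\oplus\overline{y}}$, $x\ominus y=x\otimes\overline{y}$. The natural order is $x\sqsubseteq y$ iff $x\oplus z=y$ for some $z$; it is a lattice order with bottom $0$ and top $1$. $\mathbb{M}$ is an MV-chain if $\sqsubseteq$ is total, and complete if $(M,\sqsubseteq)$ is a complete lattice. Function spaces: $\mathbb{M}^Y$ is the set of functions $Y\to M$ with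 pointwise order and operations; $[b,c]=\{d\mid b\sqsubseteq d\sqsubseteq c\}$. For $Y'\subseteq Y$, $\delta\in\mathbb{M}$, $\delta_{Y'}$ is the function with value $\delta$ on $Y'$ and $0$ elsewhere; $\delta$ also denotes the constant function $\delta_Y$. The norm is $\|a\|=\max\{a(y)\mid y\in Y\}$. A function $f:\mathbb{M}^Y\to\mathbb{M}^Z$ ($Y,Z$ finite) is non-expansive if $\|f(b)\ominus f(a)\|\sqsubseteq\|b\ominus a\|$ for all $a,b\in\mathbb{M}^Y$; such $f$ is monotone. Fixpoints: $\nu g$ denotes the greatest fixpoint of a monotone function $g$ on a complete lattice (here $\mathbb{M}^Y$, or a powerset ordered by inclusion). Approximations: for $a\in\mathbb{M}^Y$ let $[Y]_a=\{y\in Y\mid a(y)\neq 1\}$ and $\delta_a=\min\{\overline{a(y)}\mid y\in[Y]_a\}$ with $\min\emptyset=1$. For $\delta\in\mathbb{M}$ let $\alpha_{a,\delta}:\mathbf{2}^{[Y]_a}\to[a,a\oplus\delta]$, $\alpha_{a,\delta}(Y')=a\oplus\delta_{Y'}$, and $\gamma_{a,\delta}:[a,a\oplus\delta]\to\mathbf{2}^{[Y]_a}$, $\gamma_{a,\delta}(b)=\{y\in[Y]_a\mid b(y)\ominus a(y)\sqsupseteq\delta\}$. For non-expansive $f:\mathbb{M}^Y\to\mathbb{M}^Z$ put $f_{a,\delta}^{\#}=\gamma_{f(a),\delta}\circ f\circ\alpha_{a,\delta}:\mathbf{2}^{[Y]_a}\to\mathbf{2}^{[Z]_{f(a)}}$.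 For $Y'\subseteq[Y]_a$, $z\in[Z]_{f(a)}$ let $\iota_a^f(Y',z)=\max\{\theta\in\mathbb{M}\mid z\in f_{a,\theta}^{\#}(Y')\}$ (the maximum exists when $\mathbb{M}$ is a complete MV-chain), and $\iota_a^f=\min\big(\{\iota_a^f(Y',z)\mid Y'\subseteq[Y]_a,\ z\in[Z]_{f(a)},\ \iota_a^f(Y',z)\neq 0\}\cup\{\delta_a\}\big)$. The $a$-approximation of $f$ is $f_a^{\#}=f_{a,\iota_a^f}^{\#}$. *)

theory Defs
  imports "HOL-Library.FuncSet"
begin

class mv_algebra = zero +
  fixes mv_plus :: "'a \<Rightarrow> 'a \<Rightarrow> 'a"  (infixl "\<oplus>" 65)
    and mv_neg :: "'a \<Rightarrow> 'a"
  assumes mv_plus_assoc: "(x \<oplus> y) \<oplus> z = x \<oplus> (y \<oplus> z)"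
    and mv_plus_commute: "x \<oplus> y = y \<oplus> x"
    and mv_plus_zero: "x \<oplus> 0 = x"
    and mv_neg_neg: "mv_neg (mv_neg x) = x"
    and mv_plus_one: "x \<oplus> mv_neg 0 = mv_neg 0"
    and mv_lukasiewicz: "mv_neg (mv_neg x \<oplus> y) \<oplus> y = mv_neg (mv_neg y \<oplus> x) \<oplus> x"

definition mv_one :: "'m::mv_algebra"
  where "mv_one = mv_neg 0"

definition mv_times :: "'m::mv_algebra \<Rightarrow> 'm \<Rightarrow> 'm"  (infixl "\<otimes>" 70)
  where "x \<otimes> y = mv_neg (mv_neg x \<oplus> mv_neg y)"

definition mv_minus :: "'m::mv_algebra \<Rightarrow> 'm \<Rightarrow> 'm"  (infixl "\<ominus>" 65)
  where "x \<ominus> y = x \<otimes> mv_neg y"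

text \<open>The order of the type is required to be the natural order of the MV-algebra; it is then
  total and complete by the axioms of \<^class>\<open>complete_linorder\<close>.\<close>

class complete_mv_chain = mv_algebra + complete_linorder +
  assumes mv_natural_order: "x \<le> y \<longleftrightarrow> (\<exists>z. x \<oplus> z = y)"

text \<open>Functions on a set \<open>Y\<close> are represented extensionally (they are \<^const>\<open>undefined\<close> outside
  \<open>Y\<close>), so that equality and \<open>\<le>\<close> of the function type are equality and the pointwise order on \<open>Y\<close>.\<close>

definition mv_funs :: "'y set \<Rightarrow> ('y \<Rightarrow> 'm::complete_mv_chain) set"
  where "mv_funs Y = (Y \<rightarrow>\<^sub>E UNIV)"

definition mv_norm :: "'y set \<Rightarrow> ('y \<Rightarrow> 'm::complete_mv_chain) \<Rightarrow> 'm"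
  where "mv_norm Y a = Max (a ` Y)"

definition nonexpansive ::
    "'y set \<Rightarrow> 'z set \<Rightarrow> (('y \<Rightarrow> 'm::complete_mv_chain) \<Rightarrow> ('z \<Rightarrow> 'm)) \<Rightarrow> bool"
  where "nonexpansive Y Z f \<longleftrightarrow>
    (\<forall>a \<in> mv_funs Y. \<forall>b \<in> mv_funs Y.
      mv_norm Z (\<lambda>z\<in>Z. f b z \<ominus> f a z) \<le> mv_norm Y (\<lambda>y\<in>Y. b y \<ominus> a y))"

text \<open>The greatest fixpoint of \<open>g\<close> viewed as a function on the carrier \<open>C\<close>.\<close>

definition gfp_on :: "'a::order set \<Rightarrow> ('a \<Rightarrow> 'a) \<Rightarrow> 'a"
  where "gfp_on C g = (GREATEST x. x \<in> C \<and> g x = x)"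

definition non_one :: "'y set \<Rightarrow> ('y \<Rightarrow> 'm::complete_mv_chain) \<Rightarrow> 'y set"
  where "non_one Y a = {y \<in> Y. a y \<noteq> mv_one}"

definition delta_of :: "'y set \<Rightarrow> ('y \<Rightarrow> 'm::complete_mv_chain) \<Rightarrow> 'm"
  where "delta_of Y a =
    (if non_one Y a = {} then mv_one else Min ((\<lambda>y. mv_neg (a y)) ` non_one Y a))"

definition step_fun :: "'y set \<Rightarrow> 'm::complete_mv_chain \<Rightarrow> 'y set \<Rightarrow> ('y \<Rightarrow> 'm)"
  where "step_fun Y \<delta> Y' = (\<lambda>y\<in>Y. if y \<in> Y' then \<delta> else 0)"

definition alpha_map ::
    "'y set \<Rightarrow> ('y \<Rightarrow> 'm::complete_mv_chain) \<Rightarrow> 'm \<Rightarrow> 'y set \<Rightarrow> ('y \<Rightarrow> 'm)"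
  where "alpha_map Y a \<delta> Y' = (\<lambda>y\<in>Y. a y \<oplus> step_fun Y \<delta> Y' y)"

definition gamma_map ::
    "'y set \<Rightarrow> ('y \<Rightarrow> 'm::complete_mv_chain) \<Rightarrow> 'm \<Rightarrow> ('y \<Rightarrow> 'm) \<Rightarrow> 'y set"
  where "gamma_map Y a \<delta> b = {y \<in> non_one Y a. \<delta> \<le> b y \<ominus> a y}"

definition approx_at ::
    "'y set \<Rightarrow> 'z set \<Rightarrow> (('y \<Rightarrow> 'm::complete_mv_chain) \<Rightarrow> ('z \<Rightarrow> 'm))
      \<Rightarrow> ('y \<Rightarrow> 'm) \<Rightarrow> 'm \<Rightarrow> 'y set \<Rightarrow> 'z set"
  where "approx_at Y Z f a \<delta> Y' = gamma_map Z (f a) \<delta> (f (alpha_map Y a \<delta> Y'))"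

text \<open>\<^const>\<open>Greatest\<close> rather than \<^const>\<open>Max\<close>, as the set of admissible \<open>\<theta>\<close> may be infinite.\<close>

definition iota_pt ::
    "'y set \<Rightarrow> 'z set \<Rightarrow> (('y \<Rightarrow> 'm::complete_mv_chain) \<Rightarrow> ('z \<Rightarrow> 'm))
      \<Rightarrow> ('y \<Rightarrow> 'm) \<Rightarrow> 'y set \<Rightarrow> 'z \<Rightarrow> 'm"
  where "iota_pt Y Z f a Y' z = (GREATEST \<theta>. z \<in> approx_at Y Z f a \<theta> Y')"

definition iota ::
    "'y set \<Rightarrow> 'z set \<Rightarrow> (('y \<Rightarrow> 'm::complete_mv_chain) \<Rightarrow> ('z \<Rightarrow> 'm)) \<Rightarrow> ('y \<Rightarrow> 'm) \<Rightarrow> 'm"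
  where "iota Y Z f a =
    Min ({iota_pt Y Z f a Y' z | Y' z.
            Y' \<subseteq> non_one Y a \<and> z \<in> non_one Z (f a) \<and> iota_pt Y Z f a Y' z \<noteq> 0}
         \<union> {delta_of Y a})"

definition approx ::
    "'y set \<Rightarrow> 'z set \<Rightarrow> (('y \<Rightarrow> 'm::complete_mv_chain) \<Rightarrow> ('z \<Rightarrow> 'm))
      \<Rightarrow> ('y \<Rightarrow> 'm) \<Rightarrow> 'y set \<Rightarrow> 'z set"
  where "approx Y Z f a = approx_at Y Z f a (iota Y Z f a)"

definition fix_part ::
    "'y set \<Rightarrow> (('y \<Rightarrow> 'm::complete_mv_chain) \<Rightarrow> ('y \<Rightarrow> 'm)) \<Rightarrow> ('y \<Rightarrow> 'm) \<Rightarrow> 'y set"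
  where "fix_part Y f a = {y \<in> non_one Y a. a y = f a y}"

definition approx_star ::
    "'y set \<Rightarrow> (('y \<Rightarrow> 'm::complete_mv_chain) \<Rightarrow> ('y \<Rightarrow> 'm))
      \<Rightarrow> ('y \<Rightarrow> 'm) \<Rightarrow> 'y set \<Rightarrow> 'y set"
  where "approx_star Y f a Y' = approx Y Y f a Y' \<inter> fix_part Y f a"

end

(* Let b be the greatest fixpoint of f and suppose that the largest difference e = max (b - a) is
   not 0. Non-expansiveness and f a <= a force f a = a on the set Y' where e is attained. If e' < e
   is the largest difference outside Y' and t = e - e', then b exceeds a + t_{Y'} by at most e'
   everywhere, so f (a + t_{Y'}) - f a is at least e - e' = t on Y'. Admissibility of t passes down
   to the threshold iota of the approximation, so Y' is a nonempty post-fixpoint of f_a^*, and the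
   greatest fixpoint of f_a^* cannot be empty. *)

theory Submission
  imports Defs
begin

section \<open>Arithmetic in MV-chains\<close>

lemma mv_minus_eq: "x \<ominus> y = mv_neg (mv_neg x \<oplus> y)"
  by (simp add: mv_minus_def mv_times_def mv_neg_neg)

lemma mv_zero_plus: "0 \<oplus> x = (x::'m::mv_algebra)"
  by (metis mv_plus_commute mv_plus_zero)

lemma mv_one_plus: "mv_one \<oplus> x = (mv_one::'m::mv_algebra)"
  by (metis mv_plus_commute mv_plus_one mv_one_def)

text \<open>In the Lukasiewicz axiom at \<open>y = mv_neg 0\<close> the left side is absorbed to
  one, while the right side collapses to \<open>mv_neg x \<oplus> x\<close>.\<close>

lemma mv_neg_plus_self: "mv_neg x \<oplus> x = mv_one"
  using mv_lukasiewicz[of x "mv_neg 0"]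
  by (simp add: mv_plus_one mv_one_def mv_neg_neg mv_zero_plus)

text \<open>Makes the order equational, so that order facts reduce to computation in the monoid.
  Conversely, the Lukasiewicz axiom exhibits \<open>y \<ominus> x\<close> as the witness for the
  natural order.\<close>

lemma mv_le_iff_neg_plus: "x \<le> y \<longleftrightarrow> mv_neg x \<oplus> y = mv_one"
  for x y :: "'m::complete_mv_chain"
proof
  assume "x \<le> y"
  then obtain z where "x \<oplus> z = y"
    using mv_natural_order by blast
  then show "mv_neg x \<oplus> y = mv_one"
    by (metis mv_plus_assoc mv_neg_plus_self mv_one_plus)
next
  assume "mv_neg x \<oplus> y = mv_one"
  then have "y = x \<oplus> mv_neg (mv_neg y \<oplus> x)"
    using mv_lukasiewicz[of x y]
    by (simp add: mv_one_def mv_neg_neg mv_zero_plus mv_plus_commute)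
  then show "x \<le> y"
    using mv_natural_order by metis
qed

lemma mv_zero_le [simp]: "0 \<le> x" for x :: "'m::complete_mv_chain"
  using mv_natural_order mv_zero_plus by blast

lemma mv_le_one [simp]: "x \<le> mv_one" for x :: "'m::complete_mv_chain"
  by (simp add: mv_le_iff_neg_plus mv_one_def mv_plus_one)

text \<open>Residuation: by the equational form of the order, both sides say that
  \<open>mv_neg x \<oplus> y \<oplus> z\<close> is one.\<close>

lemma mv_minus_le_iff: "x \<ominus> y \<le> z \<longleftrightarrow> x \<le> z \<oplus> y"
  for x y z :: "'m::complete_mv_chain"
  by (simp add: mv_le_iff_neg_plus mv_minus_eq mv_neg_neg mv_plus_assoc mv_plus_commute[of z y])

lemma mv_minus_eq_zero_iff: "x \<ominus> y = 0 \<longleftrightarrow> x \<le> y"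
  for x y :: "'m::complete_mv_chain"
  unfolding mv_le_iff_neg_plus mv_minus_eq mv_one_def by (metis mv_neg_neg)

lemma mv_le_minus_plus: "x \<le> (x \<ominus> y) \<oplus> y" for x y :: "'m::complete_mv_chain"
  using mv_minus_le_iff by blast

lemma mv_plus_mono_left: "x \<oplus> z \<le> y \<oplus> z" if "x \<le> y"
  for x y z :: "'m::complete_mv_chain"
  using that mv_natural_order by (metis mv_plus_assoc mv_plus_commute)

lemma mv_plus_mono: "x \<oplus> u \<le> y \<oplus> v" if "x \<le> y" "u \<le> v"
  for x y u v :: "'m::complete_mv_chain"
  by (metis that mv_plus_mono_left mv_plus_commute order_trans)

lemma mv_minus_mono: "x \<ominus> u \<le> y \<ominus> v" if "x \<le> y" "v \<le> u"
  for x y u v :: "'m::complete_mv_chain"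
  by (meson that mv_minus_le_iff mv_le_minus_plus mv_plus_mono order_refl order_trans)

text \<open>The triangle inequality, rearranged by residuation so that an upper bound on
  \<open>x \<ominus> y\<close> yields a lower bound on \<open>y \<ominus> z\<close>.\<close>

lemma mv_minus_triangle: "(x \<ominus> z) \<ominus> (x \<ominus> y) \<le> y \<ominus> z"
  for x y z :: "'m::complete_mv_chain"
proof -
  have "x \<le> (x \<ominus> y) \<oplus> y"
    by (rule mv_le_minus_plus)
  also have "\<dots> \<le> (x \<ominus> y) \<oplus> ((y \<ominus> z) \<oplus> z)"
    by (intro mv_plus_mono mv_le_minus_plus order_refl)
  also have "\<dots> = ((y \<ominus> z) \<oplus> (x \<ominus> y)) \<oplus> z"
    by (metis mv_plus_assoc mv_plus_commute)
  finally show ?thesis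
    by (simp add: mv_minus_le_iff)
qed

lemma mv_minus_plus: "x \<ominus> (y \<oplus> z) = (x \<ominus> y) \<ominus> z"
  by (simp add: mv_minus_eq mv_neg_neg mv_plus_assoc)

text \<open>Only an inequality, since the sums may be truncated at one.\<close>

lemma mv_plus_minus_plus_le: "(z \<oplus> x) \<ominus> (z \<oplus> y) \<le> x \<ominus> y"
  for x y z :: "'m::complete_mv_chain"
proof -
  have "z \<oplus> x \<le> z \<oplus> ((x \<ominus> y) \<oplus> y)"
    by (intro mv_plus_mono mv_le_minus_plus order_refl)
  also have "\<dots> = (x \<ominus> y) \<oplus> (z \<oplus> y)"
    by (metis mv_plus_assoc mv_plus_commute)
  finally show ?thesis
    by (simp add: mv_minus_le_iff)
qed

lemma mv_minus_minus: "y \<ominus> (y \<ominus> x) = x" if "x \<le> y"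
  for x y :: "'m::complete_mv_chain"
proof -
  have "y \<oplus> mv_neg x = mv_one"
    using that by (simp add: mv_le_iff_neg_plus mv_plus_commute)
  then have "mv_neg (x \<oplus> mv_neg y) \<oplus> mv_neg y = mv_neg x"
    using mv_lukasiewicz[of "mv_neg x" "mv_neg y"]
    by (simp add: mv_neg_neg mv_one_def mv_zero_plus)
  then show ?thesis
    by (simp add: mv_minus_eq mv_plus_commute mv_neg_neg)
qed

section \<open>Non-expansive functions and their approximations\<close>

text \<open>Pointwise form of non-expansiveness. Nonemptiness of \<open>Y\<close> makes the norm the
  maximum of a nonempty set, so the bound passes to it.\<close>

lemma nonexpansive_le:
  assumes "nonexpansive Y Z f" "finite Y" "Y \<noteq> {}" "finite Z"
    and "c \<in> mv_funs Y" "d \<in> mv_funs Y" "z \<in> Z"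
    and "\<And>y. y \<in> Y \<Longrightarrow> d y \<ominus> c y \<le> \<theta>"
  shows "f d z \<ominus> f c z \<le> \<theta>"
proof -
  have "f d z \<ominus> f c z \<le> mv_norm Z (\<lambda>z\<in>Z. f d z \<ominus> f c z)"
    unfolding mv_norm_def using assms(4,7) by (intro Max_ge) auto
  also have "\<dots> \<le> mv_norm Y (\<lambda>y\<in>Y. d y \<ominus> c y)"
    using assms(1,5,6) by (auto simp: nonexpansive_def)
  also have "\<dots> \<le> \<theta>"
    unfolding mv_norm_def using assms(2,3,8) by (intro Max.boundedI) auto
  finally show ?thesis .
qed

lemma nonexpansive_mono:
  assumes "nonexpansive Y Z f" "finite Y" "Y \<noteq> {}" "finite Z"
    and "c \<in> mv_funs Y" "d \<in> mv_funs Y" "z \<in> Z"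
    and "\<And>y. y \<in> Y \<Longrightarrow> c y \<le> d y"
  shows "f c z \<le> f d z"
  using nonexpansive_le[OF assms(1-4,6,5,7), of 0] assms(8)
  by (simp add: mv_minus_le_iff mv_zero_plus)

lemma mv_funs_le_iff:
  assumes "c \<in> mv_funs Y" "d \<in> mv_funs Y"
  shows "c \<le> d \<longleftrightarrow> (\<forall>y\<in>Y. c y \<le> d y)"
  using assms by (auto simp: mv_funs_def PiE_def extensional_def le_fun_def)

lemma alpha_map_in_mv_funs: "alpha_map Y a \<theta> Y' \<in> mv_funs Y"
  by (simp add: alpha_map_def mv_funs_def)

lemma alpha_map_mono:
  assumes "\<theta> \<le> \<theta>'" "X \<subseteq> X'" "y \<in> Y"
  shows "alpha_map Y a \<theta> X y \<le> alpha_map Y a \<theta>' X' y"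
  using assms by (auto simp: alpha_map_def step_fun_def intro!: mv_plus_mono)

lemma approx_at_mono:
  assumes "nonexpansive Y Z f" "finite Y" "Y \<noteq> {}" "finite Z" "X \<subseteq> X'"
  shows "approx_at Y Z f a \<theta> X \<subseteq> approx_at Y Z f a \<theta> X'"
proof
  fix z assume "z \<in> approx_at Y Z f a \<theta> X"
  then have z: "z \<in> non_one Z (f a)" "\<theta> \<le> f (alpha_map Y a \<theta> X) z \<ominus> f a z"
    by (auto simp: approx_at_def gamma_map_def)
  have "f (alpha_map Y a \<theta> X) z \<le> f (alpha_map Y a \<theta> X') z"
    using z(1) assms(5)
    by (intro nonexpansive_mono[OF assms(1-4)] alpha_map_in_mv_funs alpha_map_mono)
      (auto simp: non_one_def)
  then show "z \<in> approx_at Y Z f a \<theta> X'"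
    using z order_trans[OF z(2) mv_minus_mono] by (auto simp: approx_at_def gamma_map_def)
qed

text \<open>Lowering the threshold from \<theta>' to \<theta> costs at most
  \<open>\<theta>' \<ominus> \<theta>\<close> in the argument, hence at most that much in the value
  of \<open>f\<close>. Of an increase of at least \<theta>', at least \<theta> remains.\<close>

lemma approx_at_antimono:
  assumes "nonexpansive Y Z f" "finite Y" "Y \<noteq> {}" "finite Z" "\<theta> \<le> \<theta>'"
  shows "approx_at Y Z f a \<theta>' X \<subseteq> approx_at Y Z f a \<theta> X"
proof
  fix z assume "z \<in> approx_at Y Z f a \<theta>' X"
  then have z: "z \<in> non_one Z (f a)" "\<theta>' \<le> f (alpha_map Y a \<theta>' X) z \<ominus> f a z"
    by (auto simp: approx_at_def gamma_map_def)
  let ?d = "f (alpha_map Y a \<theta>' X) z \<ominus> f (alpha_map Y a \<theta> X) z"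
  have "?d \<le> \<theta>' \<ominus> \<theta>"
  proof (rule nonexpansive_le[OF assms(1-4) alpha_map_in_mv_funs alpha_map_in_mv_funs])
    fix y assume "y \<in> Y"
    \<comment> \<open>Outside \<open>X\<close> both arguments equal \<open>a y \<oplus> 0\<close>,
      and their difference is 0.\<close>
    then show "alpha_map Y a \<theta>' X y \<ominus> alpha_map Y a \<theta> X y \<le> \<theta>' \<ominus> \<theta>"
      using mv_plus_minus_plus_le[of "a y" \<theta>' \<theta>] mv_minus_eq_zero_iff[of "a y \<oplus> 0" "a y \<oplus> 0"]
      by (auto simp: alpha_map_def step_fun_def)
  qed (use z in \<open>auto simp: non_one_def\<close>)
  then have "\<theta>' \<ominus> (\<theta>' \<ominus> \<theta>) \<le> (f (alpha_map Y a \<theta>' X) z \<ominus> f a z) \<ominus> ?d"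
    by (rule mv_minus_mono[OF z(2)])
  also have "\<dots> \<le> f (alpha_map Y a \<theta> X) z \<ominus> f a z"
    by (rule mv_minus_triangle)
  finally show "z \<in> approx_at Y Z f a \<theta> X"
    using z(1) assms(5) by (auto simp: approx_at_def gamma_map_def mv_minus_minus)
qed

text \<open>Once some threshold is admissible, the \<open>GREATEST\<close> is attained: by
  monotonicity every admissible threshold is below the increase produced by their supremum, so the
  supremum is admissible too.\<close>

lemma iota_pt_greatest:
  assumes "nonexpansive Y Z f" "finite Y" "Y \<noteq> {}" "finite Z"
    and "z \<in> approx_at Y Z f a \<theta> X"
  shows "\<theta> \<le> iota_pt Y Z f a X z" "z \<in> approx_at Y Z f a (iota_pt Y Z f a X z) X"
proof -
  define S where "S = {\<theta>. z \<in> approx_at Y Z f a \<theta> X}"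
  have z: "z \<in> non_one Z (f a)"
    using assms(5) by (simp add: approx_at_def gamma_map_def)
  have "\<theta>' \<le> f (alpha_map Y a (Sup S) X) z \<ominus> f a z" if "\<theta>' \<in> S" for \<theta>'
  proof -
    have "f (alpha_map Y a \<theta>' X) z \<le> f (alpha_map Y a (Sup S) X) z"
      using z that
      by (intro nonexpansive_mono[OF assms(1-4)] alpha_map_in_mv_funs alpha_map_mono Sup_upper)
        (auto simp: non_one_def)
    then have "f (alpha_map Y a \<theta>' X) z \<ominus> f a z \<le> f (alpha_map Y a (Sup S) X) z \<ominus> f a z"
      by (intro mv_minus_mono order_refl)
    with that show ?thesis
      by (auto simp: S_def approx_at_def gamma_map_def)
  qed
  then have mem: "z \<in> approx_at Y Z f a (Sup S) X"
    using z by (auto simp: approx_at_def gamma_map_def intro: Sup_least)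
  then have "iota_pt Y Z f a X z = Sup S"
    unfolding iota_pt_def by (intro Greatest_equality) (auto simp: S_def intro: Sup_upper)
  with mem assms(5) show "\<theta> \<le> iota_pt Y Z f a X z"
      "z \<in> approx_at Y Z f a (iota_pt Y Z f a X z) X"
    by (auto simp: S_def intro: Sup_upper)
qed

lemma iota_le_iota_pt:
  assumes "finite Y" "finite Z" "X \<subseteq> non_one Y a" "z \<in> non_one Z (f a)"
    and "iota_pt Y Z f a X z \<noteq> 0"
  shows "iota Y Z f a \<le> iota_pt Y Z f a X z"
proof -
  let ?I = "{iota_pt Y Z f a X z | X z. X \<subseteq> non_one Y a \<and> z \<in> non_one Z (f a)
    \<and> iota_pt Y Z f a X z \<noteq> 0}"
  \<comment> \<open>\<open>Min\<close> is a lower bound only for finite sets; here the indices range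
    over a finite product.\<close>
  have "?I \<subseteq> (\<lambda>(X, z). iota_pt Y Z f a X z) ` (Pow Y \<times> Z)"
    by (auto simp: non_one_def)
  then have "finite ?I"
    by (rule finite_subset) (use assms(1,2) in simp)
  with assms(3-5) show ?thesis
    unfolding iota_def by (intro Min_le) auto
qed

text \<open>A nonzero admissible \<theta> makes \<open>iota_pt\<close> nonzero, so this value takes
  part in the minimum defining \<open>iota\<close>; admissibility then descends from it to
  \<open>iota\<close>.\<close>

lemma approx_at_subset_approx:
  assumes "nonexpansive Y Z f" "finite Y" "Y \<noteq> {}" "finite Z"
    and "X \<subseteq> non_one Y a" "\<theta> \<noteq> 0"
  shows "approx_at Y Z f a \<theta> X \<subseteq> approx Y Z f a X"
proof
  fix z assume z: "z \<in> approx_at Y Z f a \<theta> X"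
  note g = iota_pt_greatest[OF assms(1-4) z]
  have "iota_pt Y Z f a X z \<noteq> 0"
    using g(1) assms(6) by (metis antisym mv_zero_le)
  moreover have "z \<in> non_one Z (f a)"
    using z by (simp add: approx_at_def gamma_map_def)
  ultimately have "iota Y Z f a \<le> iota_pt Y Z f a X z"
    by (intro iota_le_iota_pt assms(2,4,5))
  from subsetD[OF approx_at_antimono[OF assms(1-4) this] g(2)] show "z \<in> approx Y Z f a X"
    by (simp add: approx_def)
qed

section \<open>Greatest fixpoints\<close>

text \<open>Here \<open>s\<close> is the join of the post-fixpoints, given only by its universal
  property within \<open>C\<close>. This covers both pointwise suprema on \<open>mv_funs\<close> and
  unions in a powerset.\<close>

lemma gfp_on_Knaster_Tarski:
  assumes "s \<in> C" "\<And>x. x \<in> C \<Longrightarrow> g x \<in> C"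
    and mono: "\<And>x y. x \<in> C \<Longrightarrow> y \<in> C \<Longrightarrow> x \<le> y \<Longrightarrow> g x \<le> g y"
    and upper: "\<And>x. x \<in> C \<Longrightarrow> x \<le> g x \<Longrightarrow> x \<le> s"
    and least: "\<And>u. u \<in> C \<Longrightarrow> (\<And>x. x \<in> C \<Longrightarrow> x \<le> g x \<Longrightarrow> x \<le> u) \<Longrightarrow> s \<le> u"
  shows "gfp_on C g \<in> C" "g (gfp_on C g) = gfp_on C g"
    and "\<And>x. x \<in> C \<Longrightarrow> x \<le> g x \<Longrightarrow> x \<le> gfp_on C g"
proof -
  \<comment> \<open>Each post-fixpoint satisfies \<open>x \<le> g x \<le> g s\<close>, so
    \<open>g s\<close> bounds them all; then \<open>g s\<close> is itself a post-fixpoint and lies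
    below \<open>s\<close>.\<close>
  have "s \<le> g s"
    using assms(1,2) by (intro least) (meson mono upper order_trans)+
  moreover from this have "g s \<le> s"
    using assms(1,2) by (intro upper) (auto intro: mono)
  ultimately have "g s = s"
    by (rule antisym[rotated])
  moreover from this have "gfp_on C g = s"
    unfolding gfp_on_def using assms(1) upper by (intro Greatest_equality) auto
  ultimately show "gfp_on C g \<in> C" "g (gfp_on C g) = gfp_on C g"
    "\<And>x. x \<in> C \<Longrightarrow> x \<le> g x \<Longrightarrow> x \<le> gfp_on C g"
    using assms(1) upper by auto
qed

lemma gfp_on_mv_funs:
  assumes "f \<in> mv_funs Y \<rightarrow> mv_funs Y"
    and "\<And>c d. c \<in> mv_funs Y \<Longrightarrow> d \<in> mv_funs Y \<Longrightarrow> c \<le> d \<Longrightarrow> f c \<le> f d"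
  shows "gfp_on (mv_funs Y) f \<in> mv_funs Y" "f (gfp_on (mv_funs Y) f) = gfp_on (mv_funs Y) f"
proof -
  define P where "P = {x \<in> mv_funs Y. x \<le> f x}"
  \<comment> \<open>Suprema are taken on \<open>Y\<close> only, which keeps \<open>s\<close>
    undefined outside \<open>Y\<close> and thus in the carrier.\<close>
  define s where "s = (\<lambda>y\<in>Y. SUP x\<in>P. x y)"
  have s: "s \<in> mv_funs Y"
    by (simp add: s_def mv_funs_def)
  have upper: "x \<le> s" if "x \<in> mv_funs Y" "x \<le> f x" for x
    unfolding mv_funs_le_iff[OF that(1) s] using that
    by (auto simp: s_def P_def intro!: SUP_upper)
  have least: "s \<le> u" if "u \<in> mv_funs Y" "\<And>x. x \<in> mv_funs Y \<Longrightarrow> x \<le> f x \<Longrightarrow> x \<le> u" for u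
    unfolding mv_funs_le_iff[OF s that(1)] using that(2)
    by (auto simp: s_def P_def le_fun_def intro!: SUP_least)
  note gfp_on_Knaster_Tarski[of s "mv_funs Y" f, OF s funcset_mem[OF assms(1)] assms(2) upper least]
  then show "gfp_on (mv_funs Y) f \<in> mv_funs Y" "f (gfp_on (mv_funs Y) f) = gfp_on (mv_funs Y) f"
    by blast+
qed

lemma subset_gfp_on_Pow:
  assumes "\<And>X. X \<subseteq> A \<Longrightarrow> g X \<subseteq> A" "\<And>X X'. X \<subseteq> X' \<Longrightarrow> X' \<subseteq> A \<Longrightarrow> g X \<subseteq> g X'"
    and "X \<subseteq> A" "X \<subseteq> g X"
  shows "X \<subseteq> gfp_on (Pow A) g"
proof (rule gfp_on_Knaster_Tarski(3)[of "\<Union>{X \<in> Pow A. X \<subseteq> g X}"])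
  show "\<Union>{X \<in> Pow A. X \<subseteq> g X} \<subseteq> u" if "\<And>X. X \<in> Pow A \<Longrightarrow> X \<subseteq> g X \<Longrightarrow> X \<subseteq> u" for u
    using that by blast
qed (use assms in auto)

theorem theorem4p6:
  fixes Y :: "'y set"
    and f :: "('y \<Rightarrow> 'm::complete_mv_chain) \<Rightarrow> ('y \<Rightarrow> 'm)"
    and a :: "'y \<Rightarrow> 'm"
  assumes "finite Y"
    and "f \<in> mv_funs Y \<rightarrow> mv_funs Y"
    and "nonexpansive Y Y f"
    and "a \<in> mv_funs Y"
    and "f a \<le> a"
    and "gfp_on (Pow (fix_part Y f a)) (approx_star Y f a) = {}"
  shows "gfp_on (mv_funs Y) f \<le> a"
proof (cases "Y = {}")
  \<comment> \<open>The norm is then the unspecified maximum of an empty set, so non-expansiveness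
    gives no information; but the carrier has a single element.\<close>
  case True
  have "f c \<le> f d" if "c \<in> mv_funs Y" "d \<in> mv_funs Y" for c d
    using True that by (simp add: mv_funs_def)
  then have "gfp_on (mv_funs Y) f \<in> mv_funs Y"
    by (intro gfp_on_mv_funs assms(2))
  with True assms(4) show ?thesis
    by (simp add: mv_funs_def)
next
  case False
  note ne = assms(3,1) False assms(1)
  define b where "b = gfp_on (mv_funs Y) f"
  have mono: "f c \<le> f d" if "c \<in> mv_funs Y" "d \<in> mv_funs Y" "c \<le> d" for c d
    using assms(2) that
    by (subst mv_funs_le_iff[of _ Y]) (auto intro!: nonexpansive_mono[OF ne] simp: le_fun_def)
  have b: "b \<in> mv_funs Y" "f b = b"
    using gfp_on_mv_funs[OF assms(2) mono] by (auto simp: b_def)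
  define \<epsilon> where "\<epsilon> = Max ((\<lambda>y. b y \<ominus> a y) ` Y)"
  define Y' where "Y' = {y \<in> Y. b y \<ominus> a y = \<epsilon>}"
  have le_\<epsilon>: "b y \<ominus> a y \<le> \<epsilon>" if "y \<in> Y" for y
    unfolding \<epsilon>_def using that assms(1) by (intro Max_ge) auto
  have "\<epsilon> \<in> (\<lambda>y. b y \<ominus> a y) ` Y"
    unfolding \<epsilon>_def using assms(1) False by (intro Max_in) auto
  then have Y'_ne: "Y' \<noteq> {}"
    by (auto simp: Y'_def)
  have "\<epsilon> = 0"
  proof (rule ccontr)
    assume \<epsilon>: "\<epsilon> \<noteq> 0"
    have above: "a y < b y" if "y \<in> Y'" for y
      using that \<epsilon> mv_minus_eq_zero_iff[of "b y" "a y"] by (force simp: Y'_def)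
    \<comment> \<open>By non-expansiveness \<open>b y \<ominus> f a y\<close> is at most
      \<open>b y \<ominus> a y\<close>. Both subtrahends lie below \<open>b y\<close>, so
      subtracting these differences from \<open>b y\<close> recovers them and reverses the
      inequality.\<close>
    have fa: "f a y = a y" if "y \<in> Y'" for y
    proof (rule antisym)
      show "f a y \<le> a y"
        using assms(5) by (simp add: le_fun_def)
      then have "f a y \<le> b y"
        using above[OF that] by simp
      moreover have "f b y \<ominus> f a y \<le> \<epsilon>"
        using that by (intro nonexpansive_le[OF ne assms(4) b(1)] le_\<epsilon>) (auto simp: Y'_def)
      then have "b y \<ominus> f a y \<le> b y \<ominus> a y"
        using that by (simp add: b(2) Y'_def)
      then have "b y \<ominus> (b y \<ominus> a y) \<le> b y \<ominus> (b y \<ominus> f a y)"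
        by (rule mv_minus_mono[OF order_refl])
      ultimately show "a y \<le> f a y"
        using above[OF that] by (simp add: mv_minus_minus)
    qed
    have non_one: "Y' \<subseteq> non_one Y a"
    proof
      fix y assume "y \<in> Y'"
      with above[of y] show "y \<in> non_one Y a"
        by (auto simp: Y'_def non_one_def simp flip: not_le)
    qed
    with fa have sub: "Y' \<subseteq> fix_part Y f a"
      by (auto simp: fix_part_def)
    \<comment> \<open>The inserted 0 covers the case \<open>Y' = Y\<close>; as \<epsilon> is
      nonzero, \<epsilon>' still differs from it.\<close>
    define \<epsilon>' where "\<epsilon>' = Max (insert 0 ((\<lambda>y. b y \<ominus> a y) ` (Y - Y')))"
    have le_\<epsilon>': "b y \<ominus> a y \<le> \<epsilon>'" if "y \<in> Y - Y'" for y
      unfolding \<epsilon>'_def using that assms(1) by (intro Max_ge) auto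
    have "\<epsilon>' \<in> insert 0 ((\<lambda>y. b y \<ominus> a y) ` (Y - Y'))"
      unfolding \<epsilon>'_def using assms(1) by (intro Max_in) auto
    then have "\<epsilon>' \<noteq> \<epsilon>" "\<epsilon>' \<le> \<epsilon>"
      using \<epsilon> le_\<epsilon> by (auto simp: Y'_def)
    define \<theta> where "\<theta> = \<epsilon> \<ominus> \<epsilon>'"
    have \<theta>: "\<theta> \<noteq> 0" "\<epsilon> \<ominus> \<theta> = \<epsilon>'"
      using \<open>\<epsilon>' \<noteq> \<epsilon>\<close> \<open>\<epsilon>' \<le> \<epsilon>\<close> by (auto simp: \<theta>_def mv_minus_eq_zero_iff mv_minus_minus)
    have "y \<in> approx_at Y Y f a \<theta> Y'" if "y \<in> Y'" for y
    proof -
      let ?x = "f (alpha_map Y a \<theta> Y') y"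
      have "f b y \<ominus> ?x \<le> \<epsilon>'"
      proof (rule nonexpansive_le[OF ne alpha_map_in_mv_funs b(1)])
        fix u assume "u \<in> Y"
        \<comment> \<open>On \<open>Y'\<close> the difference \<epsilon> shrinks by \<theta> to
          exactly \<epsilon>'; elsewhere \<open>a\<close> is not raised and \<epsilon>' bounds the
          difference by its choice.\<close>
        then show "b u \<ominus> alpha_map Y a \<theta> Y' u \<le> \<epsilon>'"
          using \<theta>(2) le_\<epsilon>'[of u]
          by (cases "u \<in> Y'")
            (auto simp: alpha_map_def step_fun_def mv_plus_zero mv_minus_plus Y'_def)
      qed (use that in \<open>simp add: Y'_def\<close>)
      \<comment> \<open>As \<open>f b = b\<close>, at most \<epsilon>' of the gap \<epsilon> at
        \<open>y\<close> remains above \<open>?x\<close>, so \<open>?x\<close> has gained at least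
        \<theta> over \<open>a y\<close>, which is \<open>f a y\<close>.\<close>
      then have "(b y \<ominus> a y) \<ominus> \<epsilon>' \<le> (b y \<ominus> a y) \<ominus> (b y \<ominus> ?x)"
        unfolding b(2) by (rule mv_minus_mono[OF order_refl])
      also have "\<dots> \<le> ?x \<ominus> a y"
        by (rule mv_minus_triangle)
      finally have "\<theta> \<le> ?x \<ominus> f a y"
        using that by (simp add: \<theta>_def Y'_def fa)
      then show ?thesis
        using that non_one fa[OF that] by (auto simp: approx_at_def gamma_map_def non_one_def)
    qed
    then have "Y' \<subseteq> approx_star Y f a Y'"
      using approx_at_subset_approx[OF ne non_one \<theta>(1)] sub by (auto simp: approx_star_def)
    moreover have "approx_star Y f a X \<subseteq> approx_star Y f a X'" if "X \<subseteq> X'" for X X'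
      using approx_at_mono[OF ne that] by (auto simp: approx_star_def approx_def)
    ultimately have "Y' \<subseteq> gfp_on (Pow (fix_part Y f a)) (approx_star Y f a)"
      using sub by (intro subset_gfp_on_Pow) (auto simp: approx_star_def)
    with Y'_ne assms(6) show False
      by simp
  qed
  \<comment> \<open>A vanishing truncated difference is the order itself, by residuation.\<close>
  then have "b y \<le> a y" if "y \<in> Y" for y
    using le_\<epsilon>[OF that] by (simp add: mv_minus_le_iff mv_zero_plus)
  then show ?thesis
    using b(1) assms(4) by (simp add: mv_funs_le_iff flip: b_def)
qed

end
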